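(* Let $X$ be a separable, zero-dimensional, metrizable space. Then $X$ has Menger's property if, and only if, for each continuous image $Y$ of $X$ in $\mathbb{N}^{\mathbb{N}}$ (that is, for each set $Y=\Psi[X]$ with $\Psi:X\to\mathbb{N}^{\mathbb{N}}$ continuous), the family $$G=\{a\in[\mathbb{N}]^{\aleph_0} : (\forall f\in Y)\ a^+\not\le^* f\}$$ is groupwise dense.
   Context: Here $\mathbb{N}=\{0,1,2,\dots\}$. A space $X$ has Menger's property if for each sequence $\{\mathcal{U}_n\}_{n\in\mathbb{N}}$ of open covers of $X$ there exist finite sets $\mathcal{F}_n\subseteq\mathcal{U}_n$, $n\in\mathbb{N}$, such that $\bigcup_{n\in\mathbb{N}}\mathcal{F}_n$ is a cover of $X$. The Baire space $\mathbb{N}^{\mathbb{N}}$ carries the Tychonoff product topology, with $\mathbb{N}$ discrete. For $f,g\in\mathbb{N}^{\mathbb{N}}$, $f\le^* g$ means $f(n)\le g(n)$ for all but finitely many $n$. $[\mathbb{N}]^{\aleph_0}$ denotes the collection of all infinite subsets of $\mathbb{N}$. For $a\in[\mathbb{N}]^{\aleph_0}$, $a^+\in\mathbb{N}^{\mathbb{N}}$ is defined by $a^+(n)=\min\{k\in a: n<k\}$ for each $n$. For $a,b\in[\mathbb{N}]^{\aleph_0}$, $a$ is an almost subset of $b$ if $a\setminus b$ is finite. A family $G\subseteq[\mathbb{N}]^{\aleph_0}$ is groupwise dense if it contains all (infinite) almost subsets of its elements, and for each partition of $\mathbb{N}$ into finite intervals there is an infinite set of intervals in this partition whose union is a member of $G$.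 *)

theory Defs
  imports "HOL-Analysis.Analysis"
begin

definition zero_dimensional_space :: "'a topology \<Rightarrow> bool"
  where "zero_dimensional_space X \<longleftrightarrow>
    (\<exists>\<B>. (\<forall>B\<in>\<B>. openin X B \<and> closedin X B) \<and>
         (\<forall>U x. openin X U \<and> x \<in> U \<longrightarrow> (\<exists>B\<in>\<B>. x \<in> B \<and> B \<subseteq> U)))"

definition open_cover :: "'a topology \<Rightarrow> 'a set set \<Rightarrow> bool"
  where "open_cover X \<U> \<longleftrightarrow> (\<forall>U\<in>\<U>. openin X U) \<and> \<Union>\<U> = topspace X"

definition menger_space :: "'a topology \<Rightarrow> bool"
  where "menger_space X \<longleftrightarrow>
    (\<forall>\<U> :: nat \<Rightarrow> 'a set set. (\<forall>n. open_cover X (\<U> n)) \<longrightarrow>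
       (\<exists>\<F> :: nat \<Rightarrow> 'a set set. (\<forall>n. finite (\<F> n) \<and> \<F> n \<subseteq> \<U> n) \<and>
            \<Union> (\<Union>n. \<F> n) = topspace X))"

definition baire_space :: "(nat \<Rightarrow> nat) topology"
  where "baire_space = product_topology (\<lambda>_. discrete_topology UNIV) UNIV"

definition le_star :: "(nat \<Rightarrow> nat) \<Rightarrow> (nat \<Rightarrow> nat) \<Rightarrow> bool"  (infix "\<le>\<^sup>*" 50)
  where "f \<le>\<^sup>* g \<longleftrightarrow> (\<forall>\<^sub>\<infinity>n. f n \<le> g n)"

(* Only meaningful for infinite a; otherwise the minimum need not exist. *)
definition next_elem :: "nat set \<Rightarrow> nat \<Rightarrow> nat"
  where "next_elem a n = (LEAST k. k \<in> a \<and> n < k)"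

definition almost_subset :: "nat set \<Rightarrow> nat set \<Rightarrow> bool"
  where "almost_subset a b \<longleftrightarrow> finite (a - b)"

definition finite_interval_partition :: "nat set set \<Rightarrow> bool"
  where "finite_interval_partition P \<longleftrightarrow>
    partition_on UNIV P \<and> (\<forall>I\<in>P. \<exists>l u. I = {l..<u})"

definition groupwise_dense :: "nat set set \<Rightarrow> bool"
  where "groupwise_dense G \<longleftrightarrow>
    (\<forall>a\<in>G. infinite a) \<and>
    (\<forall>b\<in>G. \<forall>a. infinite a \<and> almost_subset a b \<longrightarrow> a \<in> G) \<and>
    (\<forall>P. finite_interval_partition P \<longrightarrow> (\<exists>Q\<subseteq>P. infinite Q \<and> \<Union>Q \<in> G))"

end

theory Submission
  imports Defs
begin

text \<open>
  For the forward direction, let \<open>e n\<close> be the maximum of the block of the partition containing \<open>n\<close>,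
  and replace every \<open>f \<in> Y\<close> by a larger inflationary monotone function. If \<open>a\<close> is the union of the
  blocks meeting \<open>range g\<close>, with \<open>g\<close> strictly increasing, then \<open>a\<^sup>+ \<le>\<^sup>* f\<close> forces
  \<open>g (j + 1) \<le> h (g j)\<close> for almost all \<open>j\<close>, where \<open>h = e \<circ> f \<circ> e\<close>, and so \<open>g n \<le> h\<^sup>n n\<close> for almost
  all \<open>n\<close>. The map sending \<open>f\<close> to \<open>n \<mapsto> h\<^sup>n n\<close> is continuous, hence by Menger's property some \<open>g\<close>
  escapes all the functions so obtained. Iterating \<open>h\<close> replaces Hurewicz's theorem on the
  Menger game.

  Conversely, a sequence of open covers may be refined to countable clopen covers \<open>c n 0, c n 1, \<dots>\<close>,
  and mapping \<open>x\<close> to \<open>n \<mapsto> min {m. x \<in> c n m}\<close> is continuous. If \<open>a\<^sup>+\<close> is not dominated by any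
  function in the image, then the sets \<open>c n m\<close> with \<open>m \<le> a\<^sup>+ n\<close> cover the space.
\<close>

section \<open>Second countability of separable metrizable spaces\<close>

lemma separable_metrizable_imp_second_countable:
  assumes "separable_space X" "metrizable_space X"
  shows "second_countable X"
proof -
  obtain M d where "Metric_space M d" and X: "X = Metric_space.mtopology M d"
    using assms(2) by (auto simp: metrizable_space_def)
  then interpret Metric_space M d by simp
  obtain C where C: "countable C" "C \<subseteq> M" "mtopology closure_of C = M"
    using assms(1) by (auto simp: X separable_space_def)
  define \<B> where "\<B> = (\<lambda>(c, n). mball c (1 / real (Suc n))) ` (C \<times> (UNIV :: nat set))"
  have "\<exists>V\<in>\<B>. x \<in> V \<and> V \<subseteq> U" if U: "openin mtopology U" and x: "x \<in> U" for U x
  proof -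
    obtain r where r: "r > 0" "mball x r \<subseteq> U" and "x \<in> M"
      using U x unfolding openin_mtopology by blast
    \<comment> \<open>Half of \<open>r\<close> leaves room: a ball of this radius about a point
      \<open>c\<close> within the same distance of \<open>x\<close> stays inside
      \<open>mball x r\<close>.\<close>
    obtain n where n: "1 / real (Suc n) < r / 2"
      using nat_approx_posE r(1) half_gt_zero by blast
    have "x \<in> mtopology closure_of C"
      using C(3) \<open>x \<in> M\<close> by simp
    then obtain c where c: "c \<in> C" "c \<in> mball x (1 / real (Suc n))"
      unfolding metric_closure_of using zero_less_divide_1_iff of_nat_0_less_iff by blast
    have "mball c (1 / real (Suc n)) \<subseteq> mball x r"
      by (rule mball_subset) (use c n \<open>x \<in> M\<close> in \<open>auto simp: commute\<close>)
    moreover have "x \<in> mball c (1 / real (Suc n))"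
      using c by (auto simp: commute)
    moreover have "mball c (1 / real (Suc n)) \<in> \<B>"
      using c(1) unfolding \<B>_def by (intro image_eqI[where x = "(c, n)"]) auto
    ultimately show ?thesis
      using r(2) by (meson order_trans)
  qed
  moreover have "countable \<B>" "\<forall>V\<in>\<B>. openin mtopology V"
    using C(1) by (auto simp: \<B>_def)
  ultimately show ?thesis
    unfolding X second_countable_def by (intro exI[of _ \<B>]) simp
qed

section \<open>Continuous maps into discrete spaces and the Baire space\<close>

lemma openin_preimage_discrete:
  "continuous_map X (discrete_topology UNIV) h \<Longrightarrow> openin X {x \<in> topspace X. h x \<in> U}"
  by (simp add: continuous_map_def)

text \<open>The space splits into the open sets where \<open>h\<close> equals \<open>k\<close>, and
  on each of them the map is \<open>\<Phi> k\<close>. This allows evaluation at an argument that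
  itself depends on \<open>x\<close>.\<close>

lemma continuous_map_discrete_diag:
  assumes h: "continuous_map X (discrete_topology UNIV) h"
    and \<Phi>: "\<And>k. continuous_map X (discrete_topology UNIV) (\<Phi> k)"
  shows "continuous_map X (discrete_topology UNIV) (\<lambda>x. \<Phi> (h x) x)"
proof -
  have "openin X {x \<in> topspace X. \<Phi> (h x) x \<in> U}" for U
  proof -
    have "{x \<in> topspace X. \<Phi> (h x) x \<in> U} =
        (\<Union>k. {x \<in> topspace X. h x \<in> {k}} \<inter> {x \<in> topspace X. \<Phi> k x \<in> U})"
      by auto
    moreover have "openin X ({x \<in> topspace X. h x \<in> {k}} \<inter> {x \<in> topspace X. \<Phi> k x \<in> U})" for k
      by (intro openin_Int openin_preimage_discrete h \<Phi>)
    then have "openin X (\<Union>k. {x \<in> topspace X. h x \<in> {k}} \<inter> {x \<in> topspace X. \<Phi> k x \<in> U})"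
      by blast
    ultimately show ?thesis
      by (simp only:)
  qed
  then show ?thesis
    by (simp add: continuous_map_def)
qed

lemma continuous_map_discrete_compose:
  assumes "continuous_map X (discrete_topology UNIV) h"
  shows "continuous_map X (discrete_topology UNIV) (\<lambda>x. \<phi> (h x))"
  using openin_preimage_discrete[OF assms, of "\<phi> -` U" for U]
  by (simp add: continuous_map_def)

lemma continuous_map_discrete_add:
  assumes "continuous_map X (discrete_topology UNIV) h"
    and "continuous_map X (discrete_topology UNIV) h'"
  shows "continuous_map X (discrete_topology UNIV) (\<lambda>x. h x + h' x)"
  by (rule continuous_map_discrete_diag[where \<Phi> = "\<lambda>k x. k + h' x", OF assms(1)
        continuous_map_discrete_compose[OF assms(2)]])

lemma continuous_map_discrete_sum:
  assumes "\<And>i. continuous_map X (discrete_topology UNIV) (\<lambda>x. \<Phi> i x)"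
  shows "continuous_map X (discrete_topology UNIV) (\<lambda>x. \<Sum>i\<le>(n::nat). \<Phi> i x)"
  by (induction n) (auto intro!: assms continuous_map_discrete_add)

text \<open>Each further application evaluates \<open>\<Phi> x\<close> at an argument depending on
  \<open>x\<close>, which the diagonal lemma permits.\<close>

lemma continuous_map_discrete_funpow:
  fixes \<Phi> :: "'a \<Rightarrow> 'b \<Rightarrow> 'b"
  assumes "\<And>k. continuous_map X (discrete_topology UNIV) (\<lambda>x. \<Phi> x k)"
  shows "continuous_map X (discrete_topology UNIV) (\<lambda>x. (\<Phi> x ^^ i) k)"
proof (induction i)
  case (Suc i)
  show ?case
    using continuous_map_discrete_diag[OF Suc, of "\<lambda>k x. \<Phi> x k"] assms by simp
qed simp

lemma continuous_map_baire_space: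
  "continuous_map X baire_space \<Psi> \<longleftrightarrow>
    (\<forall>n. continuous_map X (discrete_topology UNIV) (\<lambda>x. \<Psi> x n))"
  by (simp add: baire_space_def continuous_map_componentwise_UNIV)

section \<open>Functions escaping continuous images of Menger spaces\<close>

text \<open>For fixed \<open>n\<close> the fibres of \<open>\<lambda>x. \<Psi> x n\<close> form an
  open cover; selecting finitely many fibres means allowing finitely many values, which are
  bounded.\<close>

lemma menger_space_imp_exceeding:
  assumes "menger_space X" and \<Psi>: "continuous_map X baire_space \<Psi>"
  shows "\<exists>g. \<forall>x\<in>topspace X. \<exists>n\<ge>N. \<Psi> x n < g n"
proof -
  define A where "A n m = {x \<in> topspace X. \<Psi> x n \<in> {m}}" for n m
  have "openin X (A n m)" for n m
    using \<Psi> unfolding continuous_map_baire_space A_def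
    by (intro openin_preimage_discrete) simp
  moreover have "(\<Union>m. A n m) = topspace X" for n
    by (auto simp: A_def)
  \<comment> \<open>The shift by \<open>N\<close> makes every selected coordinate at least
    \<open>N\<close>.\<close>
  ultimately have "open_cover X (range (A (n + N)))" for n
    by (auto simp: open_cover_def)
  then obtain \<F> where \<F>: "\<And>n. finite (\<F> n)" "\<And>n. \<F> n \<subseteq> range (A (n + N))"
    and cov: "\<Union> (\<Union>n. \<F> n) = topspace X"
    using spec[OF assms(1)[unfolded menger_space_def], of "\<lambda>n. range (A (n + N))"] by metis
  have "\<exists>B. finite B \<and> \<F> n = A (n + N) ` B" for n
    using finite_subset_image[OF \<F>(1) \<F>(2)] by blast
  then obtain B where B: "\<And>n. finite (B n)" "\<And>n. \<F> n = A (n + N) ` B n"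
    by metis
  \<comment> \<open>\<open>Max\<close> is unspecified on the empty set, but a point covered at stage
    \<open>n\<close> shows that \<open>B n\<close> is nonempty.\<close>
  have "\<exists>n\<ge>N. \<Psi> x n < Suc (Max (B (n - N)))" if "x \<in> topspace X" for x
  proof -
    have "x \<in> \<Union> (\<Union>n. \<F> n)"
      using that cov by (simp only:)
    then obtain n where "x \<in> \<Union> (\<F> n)"
      by auto
    then have "\<Psi> x (n + N) \<in> B n"
      unfolding B(2) by (auto simp: A_def)
    then have "\<Psi> x (n + N) < Suc (Max (B (n + N - N)))"
      using Max_ge[OF B(1)] by (simp add: less_Suc_eq_le)
    then show ?thesis
      by (intro exI[of _ "n + N"]) simp
  qed
  then show ?thesis
    by (intro exI[of _ "\<lambda>n. Suc (Max (B (n - N)))"] ballI) simp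
qed

text \<open>The function supplied by the preceding lemma depends on \<open>N\<close>; a diagonal sum
  yields one \<open>g\<close> that serves all \<open>N\<close>.\<close>

lemma menger_space_imp_not_dominating:
  assumes "menger_space X" "continuous_map X baire_space \<Psi>"
  obtains g where "strict_mono g" "\<And>x. x \<in> topspace X \<Longrightarrow> \<not> g \<le>\<^sup>* \<Psi> x"
proof -
  obtain \<gamma> where \<gamma>: "\<And>N x. x \<in> topspace X \<Longrightarrow> \<exists>n\<ge>N. \<Psi> x n < \<gamma> N n"
    using menger_space_imp_exceeding[OF assms] by metis
  \<comment> \<open>\<open>\<sigma> n\<close> bounds \<open>\<gamma> N n\<close> for all
    \<open>N \<le> n\<close>; in \<open>g\<close>, the cumulative sum and the summand
    \<open>n\<close> force strict growth.\<close>
  define \<sigma> where "\<sigma> n = (\<Sum>N\<le>n. \<gamma> N n)" for n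
  define g where "g n = n + (\<Sum>i\<le>n. \<sigma> i)" for n
  show thesis
  proof
    show "strict_mono g"
      by (rule strict_monoI_Suc) (simp add: g_def)
    fix x assume x: "x \<in> topspace X"
    show "\<not> g \<le>\<^sup>* \<Psi> x"
    proof
      assume "g \<le>\<^sup>* \<Psi> x"
      then obtain N where N: "\<And>n. n \<ge> N \<Longrightarrow> g n \<le> \<Psi> x n"
        by (auto simp: le_star_def MOST_nat_le)
      obtain n where n: "n \<ge> N" "\<Psi> x n < \<gamma> N n"
        using \<gamma>[OF x] by blast
      have "\<gamma> N n \<le> \<sigma> n"
        unfolding \<sigma>_def by (rule member_le_sum) (use n(1) in auto)
      also have "\<sigma> n \<le> (\<Sum>i\<le>n. \<sigma> i)"
        by (rule member_le_sum) auto
      also have "\<dots> \<le> g n"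
        by (simp add: g_def)
      finally show False
        using n N[of n] by simp
    qed
  qed
qed

section \<open>Next elements and eventual domination\<close>

lemma next_elem_greater:
  assumes "infinite a"
  shows "next_elem a n \<in> a" "n < next_elem a n"
proof -
  have "\<exists>k. k \<in> a \<and> n < k"
    using assms by (auto simp: infinite_nat_iff_unbounded)
  then have "next_elem a n \<in> a \<and> n < next_elem a n"
    unfolding next_elem_def by (rule LeastI_ex)
  then show "next_elem a n \<in> a" "n < next_elem a n"
    by simp_all
qed

lemma next_elem_le: "k \<in> a \<Longrightarrow> n < k \<Longrightarrow> next_elem a n \<le> k"
  by (simp add: next_elem_def Least_le)

text \<open>Past the finite set \<open>a - b\<close>, the next element of \<open>a\<close> also lies
  in \<open>b\<close>, so the next element of \<open>b\<close> comes no later. This gives closure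
  under infinite almost subsets in groupwise density.\<close>

lemma next_elem_le_star_almost_subset:
  assumes "infinite a" "almost_subset a b"
  shows "next_elem b \<le>\<^sup>* next_elem a"
proof -
  obtain N where N: "\<And>k. k \<in> a - b \<Longrightarrow> k < N"
    using assms(2) unfolding almost_subset_def finite_nat_set_iff_bounded by blast
  have "next_elem b n \<le> next_elem a n" if "n \<ge> N" for n
  proof (rule next_elem_le)
    show "next_elem a n \<in> b"
      using N[of "next_elem a n"] next_elem_greater[OF assms(1), of n] that by auto
    show "n < next_elem a n"
      by (rule next_elem_greater) fact
  qed
  then show ?thesis
    by (auto simp: le_star_def MOST_nat_le)
qed

lemma le_star_trans: "f \<le>\<^sup>* g \<Longrightarrow> g \<le>\<^sup>* h \<Longrightarrow> f \<le>\<^sup>* h"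
  unfolding le_star_def by (erule (1) eventually_elim2) (rule order_trans)

section \<open>Menger's property implies groupwise density\<close>

lemma finite_interval_partition_Max_blocks:
  assumes "finite_interval_partition P"
  obtains B :: "nat \<Rightarrow> nat set" and e :: "nat \<Rightarrow> nat"
  where "\<And>n. B n \<in> P" "\<And>n. n \<in> B n" "\<And>n. finite (B n)"
    "mono e" "\<And>k n. k \<in> B n \<Longrightarrow> k \<le> e n" "\<And>k n. k \<in> B n \<Longrightarrow> e k = e n"
proof -
  have P: "partition_on UNIV P" and iv: "\<And>I. I \<in> P \<Longrightarrow> \<exists>l u. I = {l..<u}"
    using assms by (auto simp: finite_interval_partition_def)
  have "\<exists>I\<in>P. n \<in> I" for n
    using partition_onD1[OF P] by blast
  then obtain B where B: "\<And>n. B n \<in> P" "\<And>n. n \<in> B n"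
    by metis
  have fin: "finite (B n)" for n
    using iv[OF B(1), of n] by auto
  have eq: "B k = B n" if "k \<in> B n" for k n
    using disjointD[OF partition_onD2[OF P] B(1) B(1)] that B(2)[of k] by blast
  define e where "e n = Max (B n)" for n
  have e: "k \<le> e n" if "k \<in> B n" for k n
    using that fin by (simp add: e_def)
  have e_in: "e n \<in> B n" for n
    unfolding e_def using fin B(2) by (metis Max_in empty_iff)
  have "mono e"
  \<comment> \<open>If \<open>m \<le> n\<close> and \<open>e n < e m\<close>, then \<open>n\<close>
    lies between the members \<open>m\<close> and \<open>e m\<close> of the interval
    \<open>B m\<close>, so the two blocks coincide.\<close>
  proof (rule monoI, rule ccontr)
    fix m n :: nat
    assume "m \<le> n" and "\<not> e m \<le> e n"
    moreover have "n \<le> e n" by (intro e B)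
    moreover obtain l u where lu: "B m = {l..<u}"
      using iv[OF B(1)] by blast
    moreover have "m \<in> {l..<u}" "e m \<in> {l..<u}"
      using B(2)[of m] e_in[of m] by (simp_all only: lu)
    ultimately have "n \<in> B m"
      by simp
    then have "e n = e m" unfolding e_def by (simp only: eq)
    then show False
      using \<open>\<not> e m \<le> e n\<close> by simp
  qed
  moreover have "e k = e n" if "k \<in> B n" for k n
    unfolding e_def using eq[OF that] by (rule arg_cong)
  ultimately show thesis
    using that[OF B fin] e by blast
qed

text \<open>The first element \<open>t\<close> of the union beyond the block of \<open>g j\<close>
  lies in the block of some \<open>g i\<close> with \<open>i > j\<close>. As \<open>e\<close> is
  constant on blocks, \<open>g (Suc j) \<le> g i \<le> e t\<close>, while
  \<open>t \<le> f (e (g j))\<close> for large \<open>j\<close>. Iterating this gives the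
  bound.\<close>

lemma le_funpow_of_next_elem_le_star:
  fixes g f e :: "nat \<Rightarrow> nat"
  assumes g: "strict_mono g" and e: "mono e" and f: "mono f" "\<And>n. n \<le> f n"
    and B: "\<And>n. n \<in> B n" "\<And>k n. k \<in> B n \<Longrightarrow> k \<le> e n" "\<And>k n. k \<in> B n \<Longrightarrow> e k = e n"
    and le: "next_elem (\<Union>j. B (g j)) \<le>\<^sup>* f"
  shows "g \<le>\<^sup>* (\<lambda>n. ((\<lambda>k. e (f (e k))) ^^ n) n)"
proof -
  define a where "a = (\<Union>j. B (g j))"
  define h where "h k = e (f (e k))" for k
  have e_ge: "n \<le> e n" for n
    using B by blast
  have h_mono: "mono h"
    unfolding h_def by (intro monoI monoD[OF e] monoD[OF f(1)])
  have h_ge: "n \<le> h n" for n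
    using e_ge[of n] f(2)[of "e n"] e_ge[of "f (e n)"] by (simp add: h_def)
  have "range g \<subseteq> a"
    using B(1) by (auto simp: a_def)
  then have inf: "infinite a"
    using g by (meson finite_subset range_inj_infinite strict_mono_imp_inj_on)
  obtain J where J: "\<And>n. n \<ge> J \<Longrightarrow> next_elem a n \<le> f n"
    using le by (auto simp: le_star_def MOST_nat_le a_def)
  have step: "g (Suc j) \<le> h (g j)" if "j \<ge> J" for j
  proof -
    \<comment> \<open>Several values of \<open>g\<close> may share a block; starting from
      \<open>e (g j)\<close> instead of \<open>g j\<close> skips the rest of it.\<close>
    define t where "t = next_elem a (e (g j))"
    have t: "t \<in> a" "e (g j) < t"
      using next_elem_greater[OF inf] by (auto simp: t_def)
    then obtain i where i: "t \<in> B (g i)"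
      by (auto simp: a_def)
    have "\<not> i \<le> j"
    proof
      assume "i \<le> j"
      then have "e (g i) \<le> e (g j)"
        using e g by (meson monoD strict_mono_less_eq)
      then show False
        using B(2)[OF i] t(2) by simp
    qed
    then have "g (Suc j) \<le> g i"
      using g by (simp add: strict_mono_less_eq)
    also have "\<dots> \<le> e t"
      using B(3)[OF i] e_ge by metis
    also have "\<dots> \<le> h (g j)"
    proof -
      have "j \<le> g j" using g by (rule strict_mono_imp_increasing)
      then have "J \<le> e (g j)"
        using that e_ge[of "g j"] by linarith
      then have "t \<le> f (e (g j))"
        using J by (simp add: t_def)
      then show ?thesis
        using e by (simp add: h_def monoD)
    qed
    finally show ?thesis .
  qed
  have iter: "g (J + i) \<le> (h ^^ i) (g J)" for i
  proof (induction i)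
    case (Suc i)
    have "g (J + Suc i) \<le> h (g (J + i))"
      using step[of "J + i"] by simp
    also have "\<dots> \<le> h ((h ^^ i) (g J))"
      using Suc h_mono by (simp add: monoD)
    finally show ?case by simp
  qed simp
  \<comment> \<open>Since \<open>h\<close> is monotone and inflationary, the number of iterations
    can be raised from \<open>n - J\<close> to \<open>n\<close> and the starting point from
    \<open>g J\<close> to \<open>n\<close>, so that the bound no longer mentions
    \<open>J\<close>.\<close>
  have "g n \<le> (h ^^ n) n" if "n \<ge> max J (g J)" for n
  proof -
    have "g n \<le> (h ^^ (n - J)) (g J)"
      using iter[of "n - J"] that by simp
    also have "\<dots> \<le> (h ^^ n) n"
      using that by (intro funpow_mono2 h_mono) (auto simp: h_ge)
    finally show ?thesis .
  qed
  then show ?thesis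
    unfolding le_star_def MOST_nat_le h_def by blast
qed

lemma menger_space_imp_groupwise_dense:
  assumes X: "menger_space X" and \<Psi>: "continuous_map X baire_space \<Psi>"
  shows "groupwise_dense {a. infinite a \<and> (\<forall>f\<in>\<Psi> ` topspace X. \<not> next_elem a \<le>\<^sup>* f)}"
    (is "groupwise_dense ?G")
  unfolding groupwise_dense_def
proof (intro conjI ballI allI impI)
  fix a b
  assume "b \<in> ?G" "infinite a \<and> almost_subset a b"
  then show "a \<in> ?G"
    using next_elem_le_star_almost_subset le_star_trans by blast
next
  fix P assume "finite_interval_partition P"
  then obtain B and e :: "nat \<Rightarrow> nat"
    where B: "\<And>n. B n \<in> P" "\<And>n. n \<in> B n" "\<And>n. finite (B n)"
      "\<And>k n. k \<in> B n \<Longrightarrow> k \<le> e n" "\<And>k n. k \<in> B n \<Longrightarrow> e k = e n"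
      and e: "mono e"
    by (rule finite_interval_partition_Max_blocks) blast
  \<comment> \<open>The partial sums give a monotone majorant of \<open>\<Psi> x\<close>, and the
    summand \<open>k\<close> makes it inflationary. Each value uses finitely many coordinates, so
    continuity is kept.\<close>
  define f where "f x k = k + (\<Sum>i\<le>k. \<Psi> x i)" for x k
  define H where "H x n = ((\<lambda>k. e (f x (e k))) ^^ n) n" for x n
  have "continuous_map X (discrete_topology UNIV) (\<lambda>x. \<Psi> x i)" for i
    using \<Psi> by (simp add: continuous_map_baire_space)
  then have "continuous_map X (discrete_topology UNIV) (\<lambda>x. f x k)" for k
    unfolding f_def by (intro continuous_map_discrete_add continuous_map_discrete_sum) auto
  then have "continuous_map X baire_space H"
    unfolding continuous_map_baire_space H_def
    by (intro allI continuous_map_discrete_funpow continuous_map_discrete_compose[where \<phi> = e])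
  then obtain g where g: "strict_mono g" "\<And>x. x \<in> topspace X \<Longrightarrow> \<not> g \<le>\<^sup>* H x"
    using menger_space_imp_not_dominating[OF X] by blast
  define Q where "Q = range (\<lambda>j. B (g j))"
  have "range g \<subseteq> \<Union>Q"
    using B(2) by (auto simp: Q_def)
  then have inf: "infinite (\<Union>Q)"
    using g(1) by (meson finite_subset range_inj_infinite strict_mono_imp_inj_on)
  \<comment> \<open>Different \<open>j\<close> may yield the same block; finitely many finite blocks
    could not have an infinite union.\<close>
  then have "infinite Q"
    using B(3) by (auto simp: Q_def)
  moreover have "\<not> next_elem (\<Union>Q) \<le>\<^sup>* \<Psi> x" if "x \<in> topspace X" for x
  proof
    assume "next_elem (\<Union>Q) \<le>\<^sup>* \<Psi> x"
    moreover have "\<Psi> x \<le>\<^sup>* f x"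
    proof -
      have "\<Psi> x k \<le> f x k" for k
        unfolding f_def by (intro trans_le_add2 member_le_sum) auto
      then show ?thesis
        by (simp add: le_star_def)
    qed
    ultimately have "next_elem (\<Union>j. B (g j)) \<le>\<^sup>* f x"
      unfolding Q_def by (rule le_star_trans)
    moreover have "mono (f x)"
      by (rule incseq_SucI) (simp add: f_def)
    moreover have "k \<le> f x k" for k
      by (simp add: f_def)
    ultimately have "g \<le>\<^sup>* H x"
      unfolding H_def using g(1) e B by (intro le_funpow_of_next_elem_le_star) auto
    then show False
      using g(2) that by blast
  qed
  moreover have "Q \<subseteq> P"
    using B(1) by (auto simp: Q_def)
  ultimately show "\<exists>Q\<subseteq>P. infinite Q \<and> \<Union>Q \<in> ?G"
    using inf by blast
qed simp

section \<open>Groupwise density implies Menger's property\<close>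

text \<open>By zero-dimensionality the clopen sets inside members of the cover still cover, and the
  Lindelof property leaves countably many of them.\<close>

lemma Lindelof_zero_dimensional_clopen_refinement:
  assumes "Lindelof_space X" "zero_dimensional_space X" "open_cover X \<U>" "topspace X \<noteq> {}"
  obtains c :: "nat \<Rightarrow> 'a set"
  where "\<And>m. openin X (c m)" "\<And>m. closedin X (c m)" "\<And>m. \<exists>U\<in>\<U>. c m \<subseteq> U"
    "(\<Union>m. c m) = topspace X"
proof -
  define \<C> where "\<C> = {B. openin X B \<and> closedin X B \<and> (\<exists>U\<in>\<U>. B \<subseteq> U)}"
  have "topspace X \<subseteq> \<Union>\<C>"
  proof
    fix x assume "x \<in> topspace X"
    then obtain U where "U \<in> \<U>" "x \<in> U" "openin X U"
      using assms(3) by (auto simp: open_cover_def)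
    then show "x \<in> \<Union>\<C>"
      using assms(2) unfolding zero_dimensional_space_def \<C>_def by blast
  qed
  moreover have "\<Union>\<C> \<subseteq> topspace X"
    using openin_subset by (auto simp: \<C>_def)
  ultimately have "\<Union>\<C> = topspace X"
    by (rule subset_antisym[rotated])
  moreover have "openin X B" if "B \<in> \<C>" for B
    using that by (simp add: \<C>_def)
  ultimately obtain \<V> where \<V>: "countable \<V>" "\<V> \<subseteq> \<C>" "\<Union>\<V> = topspace X"
    using Lindelof_spaceD[OF assms(1), of \<C>] by metis
  \<comment> \<open>A nonempty countable family can be enumerated by all naturals, possibly with
    repetitions.\<close>
  have "\<V> \<noteq> {}"
    using assms(4) \<V>(3) by (metis Union_empty)
  then have r: "range (from_nat_into \<V>) = \<V>"
    using \<V>(1) by (rule range_from_nat_into)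
  show thesis
  proof
    fix m
    have "from_nat_into \<V> m \<in> \<C>"
      using r \<V>(2) by blast
    then show "openin X (from_nat_into \<V> m)" "closedin X (from_nat_into \<V> m)"
      "\<exists>U\<in>\<U>. from_nat_into \<V> m \<subseteq> U"
      by (auto simp: \<C>_def)
  next
    show "(\<Union>m. from_nat_into \<V> m) = topspace X"
      using r \<V>(3) by simp
  qed
qed

text \<open>The value \<open>m\<close> is attained exactly on \<open>c m\<close> minus finitely many
  earlier sets; this is open because those sets are closed.\<close>

lemma continuous_map_discrete_LEAST_clopen:
  fixes c :: "nat \<Rightarrow> 'a set"
  assumes "\<And>m. openin X (c m)" "\<And>m. closedin X (c m)" "(\<Union>m. c m) = topspace X"
  shows "continuous_map X (discrete_topology UNIV) (\<lambda>x. LEAST m. x \<in> c m)"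
proof -
  have "openin X {x \<in> topspace X. (LEAST m. x \<in> c m) \<in> U}" for U
  proof -
    have "{x \<in> topspace X. (LEAST m. x \<in> c m) \<in> U} = (\<Union>m\<in>U. c m - (\<Union>i<m. c i))" (is "?L = ?R")
    proof
      show "?L \<subseteq> ?R"
      proof
        fix x assume x: "x \<in> ?L"
        then have "\<exists>m. x \<in> c m"
          using assms(3) by blast
        then have "x \<in> c (LEAST m. x \<in> c m)"
          by (rule LeastI_ex)
        then show "x \<in> ?R"
          using x not_less_Least by blast
      qed
      show "?R \<subseteq> ?L"
      proof
        fix x assume "x \<in> ?R"
        then obtain m where m: "m \<in> U" "x \<in> c m" "\<And>i. i < m \<Longrightarrow> x \<notin> c i"
          by auto
        then have "(LEAST m. x \<in> c m) = m"
          by (metis LeastI linorder_neqE_nat not_less_Least)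
        then show "x \<in> ?L"
          using m assms(3) by auto
      qed
    qed
    moreover have "openin X (c m - (\<Union>i<m. c i))" for m
      using assms by (intro openin_diff closedin_Union) auto
    ultimately show ?thesis
      by auto
  qed
  then show ?thesis
    by (simp add: continuous_map_def)
qed

lemma menger_space_if_next_elem_undominated:
  assumes lin: "Lindelof_space X" and zd: "zero_dimensional_space X"
    and ex: "\<And>\<Psi>. continuous_map X baire_space \<Psi> \<Longrightarrow>
      \<exists>a. \<forall>x\<in>topspace X. \<not> next_elem a \<le>\<^sup>* \<Psi> x"
  shows "menger_space X"
proof (cases "topspace X = {}")
  case True
  then show ?thesis
    unfolding menger_space_def by (intro allI impI exI[of _ "\<lambda>_. {}"]) auto
next
  case False
  show ?thesis
    unfolding menger_space_def
  proof (intro allI impI)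
    fix \<U> :: "nat \<Rightarrow> 'a set set"
    assume \<U>: "\<forall>n. open_cover X (\<U> n)"
    have "\<exists>c. (\<forall>m::nat. openin X (c m) \<and> closedin X (c m) \<and> (\<exists>U\<in>\<U> n. c m \<subseteq> U)) \<and>
        (\<Union>m. c m) = topspace X" for n
      using Lindelof_zero_dimensional_clopen_refinement[OF lin zd \<U>[rule_format, of n] False] by metis
    then obtain c :: "nat \<Rightarrow> nat \<Rightarrow> 'a set"
      where c: "\<And>n m. openin X (c n m)" "\<And>n m. closedin X (c n m)"
        "\<And>n m. \<exists>U\<in>\<U> n. c n m \<subseteq> U" "\<And>n. (\<Union>m. c n m) = topspace X"
      by metis
    \<comment> \<open>Menger's property asks for members of the original covers, so each refining
      set is enlarged to one of them.\<close>
    obtain u where u: "\<And>n m. u n m \<in> \<U> n" "\<And>n m. c n m \<subseteq> u n m"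
      using c(3) by metis
    define \<Psi> where "\<Psi> x n = (LEAST m. x \<in> c n m)" for x n
    have "continuous_map X baire_space \<Psi>"
      unfolding continuous_map_baire_space \<Psi>_def
      using c by (intro allI continuous_map_discrete_LEAST_clopen) auto
    then obtain a where a: "\<And>x. x \<in> topspace X \<Longrightarrow> \<not> next_elem a \<le>\<^sup>* \<Psi> x"
      using ex by blast
    define \<F> where "\<F> n = u n ` {..next_elem a n}" for n
    have fin: "finite (\<F> n)" "\<F> n \<subseteq> \<U> n" for n
      using u(1) by (auto simp: \<F>_def)
    have "x \<in> \<Union> (\<Union>n. \<F> n)" if x: "x \<in> topspace X" for x
    proof -
      \<comment> \<open>Non-domination gives such an \<open>n\<close>, and one coordinate already
        places \<open>x\<close> in a selected set.\<close>
      obtain n where n: "\<Psi> x n \<le> next_elem a n"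
        using a[OF x] by (auto simp: le_star_def MOST_nat_le) (meson nat_le_linear)
      have "\<exists>m. x \<in> c n m"
        using c(4) x by blast
      then have "x \<in> c n (\<Psi> x n)"
        unfolding \<Psi>_def by (rule LeastI_ex)
      then have "x \<in> u n (\<Psi> x n)"
        using u(2) by blast
      moreover have "u n (\<Psi> x n) \<in> \<F> n"
        using n by (simp add: \<F>_def)
      ultimately show ?thesis
        by blast
    qed
    moreover have "\<Union> (\<Union>n. \<F> n) \<subseteq> topspace X"
    proof -
      have "\<Union> (\<F> n) \<subseteq> topspace X" for n
        using Union_mono[OF fin(2)] \<U> by (simp add: open_cover_def)
      then show ?thesis
        by auto
    qed
    ultimately have "\<Union> (\<Union>n. \<F> n) = topspace X"
      by (metis subset_antisym subsetI)
    then show "\<exists>\<F>. (\<forall>n. finite (\<F> n) \<and> \<F> n \<subseteq> \<U> n) \<and> \<Union> (\<Union>n. \<F> n) = topspace X"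
      using fin by (intro exI[of _ \<F>]) simp
  qed
qed

text \<open>The singletons \<open>{n..<Suc n}\<close> form a partition into finite intervals, and
  some union of them must belong to the family.\<close>

lemma groupwise_dense_nonempty:
  assumes "groupwise_dense G"
  shows "G \<noteq> {}"
proof -
  have "\<exists>l u. {n} = {l..<u}" for n :: nat
    by (intro exI[of _ n] exI[of _ "Suc n"]) auto
  then have "finite_interval_partition (range (\<lambda>n. {n}))"
    by (auto simp: finite_interval_partition_def intro: partition_on_singletons)
  then show ?thesis
    using assms unfolding groupwise_dense_def by blast
qed

theorem theorem4:
  fixes X :: "'a topology"
  assumes "separable_space X"
    and "zero_dimensional_space X"
    and "metrizable_space X"
  shows "menger_space X \<longleftrightarrow>
    (\<forall>Y. (\<exists>\<Psi>. continuous_map X baire_space \<Psi> \<and> Y = \<Psi> ` topspace X) \<longrightarrow>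
      groupwise_dense {a. infinite a \<and> (\<forall>f\<in>Y. \<not> (next_elem a \<le>\<^sup>* f))})"
    (is "_ \<longleftrightarrow> ?R")
proof
  assume "menger_space X"
  then show ?R
    using menger_space_imp_groupwise_dense by blast
next
  assume R: ?R
  show "menger_space X"
  proof (rule menger_space_if_next_elem_undominated)
    \<comment> \<open>Separability and metrizability enter through second countability.\<close>
    show "Lindelof_space X"
      using assms separable_metrizable_imp_second_countable second_countable_imp_Lindelof_space
      by blast
    show "zero_dimensional_space X" by fact
    fix \<Psi> assume "continuous_map X baire_space \<Psi>"
    then have "{a. infinite a \<and> (\<forall>f\<in>\<Psi> ` topspace X. \<not> next_elem a \<le>\<^sup>* f)} \<noteq> {}"
      using R by (intro groupwise_dense_nonempty) blast
    then show "\<exists>a. \<forall>x\<in>topspace X. \<not> next_elem a \<le>\<^sup>* \<Psi> x"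
      by blast
  qed
qed

end
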